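(* Let $n\ge1$, $k\in\mathbb Z_{\ge0}$, and let $x=(x_1<\dots<x_n)$ and $y=(y_1<\dots<y_n)$ be strictly increasing $n$-tuples of integers. Let $$P(k,x,y)=\frac{b^{(k)}_{xy}}{(2n)^k}$$ be the probability that $n$ walkers in $\mathbb Z$ go from $x_1,\dots,x_n$ to $y_1,\dots,y_n$ in $k$ steps and do not intersect. Define the difference operators $$\mathcal A_1=\sum_{i=1}^n\Big(\frac{k}{2n}\Lambda_k^{-1}\partial^+_{2y_i}+x_i\partial^-_{x_i}+\partial^+_{y_i}y_i-(x_i-y_i)\Big),$$ $$\mathcal A_2=\sum_{i=1}^n\Big(\frac{k}{2n}\Lambda_k^{-1}\partial^+_{2x_i}+y_i\partial^-_{y_i}+\partial^+_{x_i}x_i-(y_i-x_i)\Big).$$ Then $$\mathcal A_iP(k,x,y)=0\qquad\text{for } i=1,2.$$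
   Context: The walk: at each step exactly one of the $n$ walkers moves, by one unit to the left or to the right, all $2n$ possible moves being equally likely. $b^{(k)}_{xy}$ is the number of ways that $n$ non-intersecting walkers in $\mathbb Z$ move in this manner from $x$ to $y$ in $k$ steps. Convention: $b^{(k)}_{xy}=0$ (hence $P(k,x,y)=0$) when the strict inequalities $x_1<\dots<x_n$ and $y_1<\dots<y_n$ are not satisfied. For functions $f(k,x,y)$ and $\alpha\in\mathbb Z\setminus\{0\}$, with $e_i$ the $i$-th unit vector: $\partial^+_{\alpha x_i}f=f(k,x+\alpha e_i,y)-f(k,x,y)$, $\partial^-_{\alpha x_i}f=f(k,x,y)-f(k,x-\alpha e_i,y)$, similarly for $y_i$, and $\Lambda_k^{-1}f=f(k-1,x,y)$. The expression $\partial^+_{y_i}y_i$ denotes the operator "multiply by $y_i$, then apply $\partial^+_{y_i}$", so that $\partial^+_{y_i}y_if=(y_i+1)f(k,x,y+e_i)-y_if(k,x,y)$, and likewise for $x_i$; $k\Lambda_k^{-1}$ means first apply $\Lambda_k^{-1}$, then multiply by $k$.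
   Formalization: With P=0 at out-of-order tuples the claim fails (n=2, k=1, x=(1,2), y=(0,1) gives A_1P=1/4); instead P is continued antisymmetrically in x and in y, which changes A_1P (A_2P) only if some y_{i+1}=y_i+1 (x_{i+1}=x_i+1). *)

theory Defs
  imports Complex_Main
begin

text \<open>A configuration of \<open>n\<close> walkers is an integer list of length \<open>n\<close>. List indices start at 0, so
  \<open>x ! i\<close> is the coordinate \<open>x\<^sub>i\<^sub>+\<^sub>1\<close>, and \<open>shift a i x\<close> is \<open>x + a e\<^sub>i\<^sub>+\<^sub>1\<close>.\<close>

definition shift :: "int \<Rightarrow> nat \<Rightarrow> int list \<Rightarrow> int list" where
  "shift a i x = x[i := x ! i + a]"

definition step :: "int list \<Rightarrow> int list \<Rightarrow> bool" where
  "step x z \<longleftrightarrow> (\<exists>i<length x. z = shift 1 i x \<or> z = shift (- 1) i x)"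

definition walks :: "nat \<Rightarrow> int list \<Rightarrow> int list \<Rightarrow> int list list set" where
  "walks k x y = {w. length w = Suc k \<and> w ! 0 = x \<and> w ! k = y \<and>
     (\<forall>t\<le>k. sorted_wrt (<) (w ! t)) \<and> (\<forall>t<k. step (w ! t) (w ! Suc t))}"

text \<open>The endpoints are among the configurations required to be strictly increasing, so \<open>b k x y = 0\<close>
  unless both \<open>x\<close> and \<open>y\<close> are strictly increasing.\<close>

definition b :: "nat \<Rightarrow> int list \<Rightarrow> int list \<Rightarrow> nat" where
  "b k x y = card (walks k x y)"

type_synonym kernel = "nat \<Rightarrow> int list \<Rightarrow> int list \<Rightarrow> real"

definition P :: "nat \<Rightarrow> kernel" where
  "P n k x y = real (b k x y) / (2 * real n) ^ k"

text \<open>The difference operator \<open>\<partial>\<^sup>+\<close> with step 2 evaluates its argument at tuples \<open>y + 2 e\<^sub>i\<close>. If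
  \<open>y\<^sub>i\<^sub>+\<^sub>1 = y\<^sub>i + 1\<close>, then in this tuple walker \<open>i\<close> has passed walker \<open>i + 1\<close>. At such a tuple the
  transition probability has to be continued antisymmetrically, as in the Karlin-McGregor determinant
  and in the representation of \<open>b\<close> by an integral over the unitary group; continuing it by 0 makes the
  difference equations false (lemma \<open>zero_continuation_fails\<close> below). The two continuations agree
  (value 0) at tuples with a repeated entry, and at all tuples the operators reach unless two walkers
  are on neighbouring sites (lemmas \<open>A1_alternating_eq\<close>, \<open>A2_alternating_eq\<close>).\<close>

text \<open>The sign of the permutation sorting \<open>x\<close>, and 0 if \<open>x\<close> has a repeated entry.\<close>

definition alt :: "int list \<Rightarrow> int" where
  "alt x = (\<Prod>j<length x. \<Prod>i<j. sgn (x ! j - x ! i))"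

definition alternating :: "kernel \<Rightarrow> kernel" where
  "alternating f k x y = of_int (alt x) * of_int (alt y) * f k (sort x) (sort y)"

definition dplus_x :: "int \<Rightarrow> nat \<Rightarrow> kernel \<Rightarrow> kernel" where
  "dplus_x a i f k x y = f k (shift a i x) y - f k x y"

definition dminus_x :: "int \<Rightarrow> nat \<Rightarrow> kernel \<Rightarrow> kernel" where
  "dminus_x a i f k x y = f k x y - f k (shift (- a) i x) y"

definition dplus_y :: "int \<Rightarrow> nat \<Rightarrow> kernel \<Rightarrow> kernel" where
  "dplus_y a i f k x y = f k x (shift a i y) - f k x y"

definition dminus_y :: "int \<Rightarrow> nat \<Rightarrow> kernel \<Rightarrow> kernel" where
  "dminus_y a i f k x y = f k x y - f k x (shift (- a) i y)"

definition mult_x :: "nat \<Rightarrow> kernel \<Rightarrow> kernel" where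
  "mult_x i f k x y = of_int (x ! i) * f k x y"

definition mult_y :: "nat \<Rightarrow> kernel \<Rightarrow> kernel" where
  "mult_y i f k x y = of_int (y ! i) * f k x y"

text \<open>Subtraction on \<^typ>\<open>nat\<close> truncates, but \<open>Lambda_inv\<close> is only used with the factor \<open>k\<close> in front
  of it, which vanishes at \<open>k = 0\<close>.\<close>

definition Lambda_inv :: "kernel \<Rightarrow> kernel" where
  "Lambda_inv f k x y = f (k - 1) x y"

definition A1 :: "nat \<Rightarrow> kernel \<Rightarrow> kernel" where
  "A1 n f k x y = (\<Sum>i<n.
       real k / (2 * real n) * Lambda_inv (dplus_y 2 i f) k x y
     + mult_x i (dminus_x 1 i f) k x y
     + dplus_y 1 i (mult_y i f) k x y
     - of_int (x ! i - y ! i) * f k x y)"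

definition A2 :: "nat \<Rightarrow> kernel \<Rightarrow> kernel" where
  "A2 n f k x y = (\<Sum>i<n.
       real k / (2 * real n) * Lambda_inv (dplus_x 2 i f) k x y
     + mult_y i (dminus_y 1 i f) k x y
     + dplus_x 1 i (mult_x i f) k x y
     - of_int (y ! i - x ! i) * f k x y)"

lemma length_shift [simp]: "length (shift a i x) = length x"
  by (simp add: shift_def)

lemma alt_increasing:
  assumes "sorted_wrt (<) x"
  shows "alt x = 1"
  using assms unfolding alt_def sorted_wrt_iff_nth_less
  by (intro prod.neutral ballI) (auto intro!: prod.neutral)

lemma alt_repeated:
  assumes "\<not> distinct x"
  shows "alt x = 0"
proof -
  obtain i j where "i < j" "j < length x" "x ! i = x ! j"
    using assms by (metis distinct_conv_nth linorder_neqE_nat)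
  then show ?thesis
    unfolding alt_def by (intro prod_zero bexI[of _ j] bexI[of _ i]) auto
qed

lemma b_not_increasing:
  assumes "\<not> sorted_wrt (<) x \<or> \<not> sorted_wrt (<) y"
  shows "b k x y = 0"
proof -
  have "walks k x y = {}"
    using assms by (auto simp: walks_def)
  then show ?thesis by (simp add: b_def)
qed

lemma alternating_increasing:
  assumes "sorted_wrt (<) x" "sorted_wrt (<) y"
  shows "alternating f k x y = f k x y"
proof -
  have "sort x = x" "sort y = y"
    using assms by (auto simp: strict_sorted_iff intro: sorted_sort_id)
  then show ?thesis using assms by (simp add: alternating_def alt_increasing)
qed

lemma alternating_P_eq:
  assumes "sorted_wrt (<) x \<or> \<not> distinct x" "sorted_wrt (<) y \<or> \<not> distinct y"
  shows "alternating (P n) k x y = P n k x y"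
proof (cases "sorted_wrt (<) x \<and> sorted_wrt (<) y")
  case True
  then show ?thesis by (simp add: alternating_increasing)
next
  case False
  then have "\<not> distinct x \<or> \<not> distinct y"
    using assms by blast
  then have "alternating (P n) k x y = 0"
    by (auto simp: alternating_def alt_repeated)
  moreover have "P n k x y = 0"
    using False by (simp add: P_def b_not_increasing)
  ultimately show ?thesis by simp
qed

lemma shift_increasing_or_repeated:
  assumes x: "sorted_wrt (<) x"
    and a: "a = 1 \<or> a = - 1 \<or> a = 2 \<and> (\<forall>j. Suc j < length x \<longrightarrow> x ! Suc j \<noteq> x ! j + 1)"
    and i: "i < length x"
  shows "sorted_wrt (<) (shift a i x) \<or> \<not> distinct (shift a i x)"
proof (rule disjCI)
  assume d: "\<not> \<not> distinct (shift a i x)"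
  have "shift a i x ! j < shift a i x ! Suc j" if j: "Suc j < length x" for j
  proof -
    have "x ! j < x ! Suc j"
      using x j by (simp add: sorted_wrt_iff_nth_less)
    moreover have "shift a i x ! j \<noteq> shift a i x ! Suc j"
      using d j by (simp add: nth_eq_iff_index_eq)
    moreover have "x ! Suc j \<noteq> x ! j + 1 \<or> a \<noteq> 2"
      using a j by auto
    ultimately show ?thesis
      using a i j by (auto simp: shift_def nth_list_update split: if_splits)
  qed
  then show "sorted_wrt (<) (shift a i x)"
    by (subst sorted_wrt_iff_nth_Suc_transp) (auto intro: transpI)
qed

lemma A1_alternating_eq:
  assumes "length x = n" "length y = n" "sorted_wrt (<) x" "sorted_wrt (<) y"
    and "\<forall>j. Suc j < n \<longrightarrow> y ! Suc j \<noteq> y ! j + 1"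
  shows "A1 n (alternating (P n)) k x y = A1 n (P n) k x y"
  unfolding A1_def Lambda_inv_def dplus_y_def dminus_x_def mult_x_def mult_y_def
  using assms by (intro sum.cong refl) (simp add: alternating_P_eq shift_increasing_or_repeated)

lemma A2_alternating_eq:
  assumes "length x = n" "length y = n" "sorted_wrt (<) x" "sorted_wrt (<) y"
    and "\<forall>j. Suc j < n \<longrightarrow> x ! Suc j \<noteq> x ! j + 1"
  shows "A2 n (alternating (P n)) k x y = A2 n (P n) k x y"
  unfolding A2_def Lambda_inv_def dplus_x_def dminus_y_def mult_x_def mult_y_def
  using assms by (intro sum.cong refl) (simp add: alternating_P_eq shift_increasing_or_repeated)

lemma b_0: "b 0 x y = (if x = y \<and> sorted_wrt (<) x then 1 else 0)"
proof -
  have "walks 0 x y = (if x = y \<and> sorted_wrt (<) x then {[x]} else {})"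
    by (auto simp: walks_def length_Suc_conv)
  then show ?thesis by (auto simp: b_def)
qed

lemma b_1: "b (Suc 0) x y = (if sorted_wrt (<) x \<and> sorted_wrt (<) y \<and> step x y then 1 else 0)"
proof -
  have "walks (Suc 0) x y =
      (if sorted_wrt (<) x \<and> sorted_wrt (<) y \<and> step x y then {[x, y]} else {})"
    by (auto simp: walks_def length_Suc_conv le_Suc_eq)
  then show ?thesis by (simp add: b_def)
qed

lemma zero_continuation_fails: "A1 2 (P 2) 1 [1, 2] [0, 1] = 1 / 4"
proof -
  have step2: "step [p, q] z \<longleftrightarrow> z \<in> {[p + 1, q], [p - 1, q], [p, q + 1], [p, q - 1]}" for p q z
    by (auto simp: step_def shift_def less_Suc_eq)
  show ?thesis
    by (simp add: A1_def Lambda_inv_def dplus_y_def dminus_x_def mult_x_def mult_y_def P_def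
        b_0 b_1 step2 shift_def numeral_2_eq_2)
qed

end

theory Submission
  imports Defs "HOL-Combinatorics.Permutations"
begin

text \<open>
  Without the condition of non-intersection the theorem is a statement about one coordinate at a time.
  Let \<open>g\<^sub>k(d)\<close> be the coefficient of \<open>z\<^sup>d\<close> in the \<open>k\<close>-th power of \<open>\<Sum>\<^sub>j (z\<^sub>j + 1/z\<^sub>j)\<close>, that is, the number
  of unconstrained walks of \<open>k\<close> steps with displacement \<open>d\<close>. Applying \<open>z\<^sub>i \<partial>/\<partial>z\<^sub>i\<close> to that power gives
  \<open>d\<^sub>i g\<^sub>k(d) = k (g\<^sub>k\<^sub>-\<^sub>1(d - e\<^sub>i) - g\<^sub>k\<^sub>-\<^sub>1(d + e\<^sub>i))\<close> (lemma \<open>free_walks_derivative\<close>). At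
  \<open>d = y + e\<^sub>i - x\<close> this equation says that the \<open>i\<close>-th summand of \<open>A\<^sub>1\<close>, applied to unconstrained
  walks, is 0, even before summation over \<open>i\<close>.

  Non-intersecting walks are reached by the reflection principle of Karlin and McGregor. The signed sum
  of unconstrained counts over all permutations of the end point satisfies the same recursion in \<open>k\<close>
  as \<open>b\<close>. It is alternating, hence 0 at tuples with a repeated entry; so for ordered tuples the terms
  in which a walker steps onto its neighbour drop out, as they do for \<open>b\<close>
  (\<open>b_eq_signed_walks\<close>). Alternating functions that agree on increasing tuples agree everywhere, and so the
  signed sum is the alternating continuation of \<open>b\<close> (\<open>alternating_P_eq_signed_walks\<close>). Finally
  \<open>A\<^sub>1\<close> involves the coordinates of \<open>y\<close> symmetrically and therefore passes to the individual
  permutations in the signed sum (\<open>signed_walks_identity\<close>). Reversal of time exchanges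
  \<open>A\<^sub>1\<close> and \<open>A\<^sub>2\<close>.
\<close>

section \<open>Shifts of a coordinate\<close>

lemma shift_nth: "i < length x \<Longrightarrow> shift a j x ! i = (if i = j then x ! i + a else x ! i)"
  by (simp add: shift_def nth_list_update)

lemma shift_0 [simp]: "shift 0 i x = x"
  by (simp add: shift_def)

lemma shift_shift: "shift a i (shift c i x) = shift (c + a) i x"
  by (rule nth_equalityI) (auto simp: shift_nth)

lemma shift_commute: "shift a i (shift c j x) = shift c j (shift a i x)"
  by (rule nth_equalityI) (auto simp: shift_nth)

lemma shift_eq_iff: "shift a i x = y \<longleftrightarrow> x = shift (- a) i y"
  by (auto simp: shift_shift)

lemma shift_permute_list:
  assumes p: "p permutes {..<length x}" and i: "i < length x"
  shows "permute_list p (shift a (p i) x) = shift a i (permute_list p x)"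
proof (rule nth_equalityI)
  fix j assume "j < length (permute_list p (shift a (p i) x))"
  then have j: "j < length x" by simp
  then have pj: "p j < length x"
    using permutes_in_image[OF p, of j] by simp
  have "p j = p i \<longleftrightarrow> j = i"
    using permutes_inj[OF p] by (auto dest: injD)
  then show "permute_list p (shift a (p i) x) ! j = shift a i (permute_list p x) ! j"
    using p j pj by (simp add: permute_list_nth shift_nth)
qed simp

section \<open>Unconstrained walks\<close>

text \<open>The count is real-valued because it enters signed sums and quotients only.\<close>

fun free_walks :: "nat \<Rightarrow> int list \<Rightarrow> int list \<Rightarrow> real" where
  "free_walks 0 x y = (if x = y then 1 else 0)"
| "free_walks (Suc k) x y =
     (\<Sum>i<length x. free_walks k (shift 1 i x) y + free_walks k (shift (- 1) i x) y)"

lemma free_walks_shift: "free_walks k (shift a i x) y = free_walks k x (shift (- a) i y)"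
proof (induction k arbitrary: x)
  case 0
  show ?case by (simp add: shift_eq_iff[of a i x y])
next
  case (Suc k)
  show ?case by (simp add: shift_commute[of _ _ a i] Suc.IH)
qed

lemma free_walks_permute:
  assumes "length x = n" "length y = n" and p: "p permutes {..<n}"
  shows "free_walks k (permute_list p x) (permute_list p y) = free_walks k x y"
  using assms(1)
proof (induction k arbitrary: x)
  case 0
  have "permute_list p x = permute_list p y \<longleftrightarrow> x = y"
  proof
    assume eq: "permute_list p x = permute_list p y"
    show "x = y"
    proof (rule nth_equalityI)
      fix i assume "i < length x"
      then have "i \<in> p ` {..<n}"
        using permutes_image[OF p] 0 by simp
      then obtain j where "j < n" "i = p j" by auto
      then show "x ! i = y ! i"
        using arg_cong[OF eq, of "\<lambda>z. z ! j"] p 0 assms(2) by (simp add: permute_list_nth)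
    qed (use 0 assms(2) in simp)
  qed simp
  then show ?case by simp
next
  case (Suc k)
  have *: "free_walks k (shift a i (permute_list p x)) (permute_list p y)
      = free_walks k (shift a (p i) x) y" if "i < n" for a i
    using Suc.IH[of "shift a (p i) x"] shift_permute_list[of p x i a] p that Suc.prems by simp
  have "free_walks (Suc k) (permute_list p x) (permute_list p y)
      = (\<Sum>i<n. free_walks k (shift 1 (p i) x) y + free_walks k (shift (- 1) (p i) x) y)"
    using Suc.prems by (simp add: *)
  also have "\<dots> = (\<Sum>i<n. free_walks k (shift 1 i x) y + free_walks k (shift (- 1) i x) y)"
    using sum.permute[OF p, of "\<lambda>i. free_walks k (shift 1 i x) y + free_walks k (shift (- 1) i x) y"]
    by (simp add: o_def)
  finally show ?case using Suc.prems by simp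
qed

lemma free_walks_symmetric:
  assumes "length x = length y"
  shows "free_walks k x y = free_walks k y x"
  using assms
proof (induction k arbitrary: x y)
  case (Suc k)
  have "free_walks k (shift a i x) y = free_walks k (shift (- a) i y) x" for a i
    using Suc.IH[of "shift a i x" y] Suc.prems free_walks_shift[of k "- a" i y x] by simp
  from this[of 1] this[of "- 1"] Suc.prems show ?case
    by (simp add: add.commute)
qed auto

text \<open>This is the coefficient form of \<open>z\<^sub>i \<partial>/\<partial>z\<^sub>i\<close> acting on the \<open>k\<close>-th power of
  \<open>\<Sum>\<^sub>j (z\<^sub>j + 1/z\<^sub>j)\<close>. In the induction the factor \<open>y\<^sub>i - x\<^sub>i\<close> differs from the one needed after the
  first step only if that step moves coordinate \<open>i\<close>; these two corrections raise \<open>k\<close> to \<open>k + 1\<close>.\<close>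

lemma free_walks_derivative:
  assumes "i < length x"
  shows "of_int (y ! i - x ! i) * free_walks k x y
    = real k * (free_walks (k - 1) (shift 1 i x) y - free_walks (k - 1) (shift (- 1) i x) y)"
  using assms
proof (induction k arbitrary: x)
  case 0
  then show ?case by simp
next
  case (Suc k)
  let ?D = "\<lambda>k x. free_walks k (shift 1 i x) y - free_walks k (shift (- 1) i x) y"
  let ?c = "real_of_int (y ! i - x ! i)"
  have move: "?c * free_walks k (shift a j x) y
      = real k * ?D (k - 1) (shift a j x) + (if j = i then of_int a * free_walks k (shift a j x) y else 0)"
    if "j < length x" for a j
    using Suc.IH[of "shift a j x"] Suc.prems that by (auto simp: shift_nth algebra_simps)
  have "?c * free_walks (Suc k) x y
      = (\<Sum>j<length x. ?c * free_walks k (shift 1 j x) y + ?c * free_walks k (shift (- 1) j x) y)"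
    by (simp add: sum_distrib_left distrib_left)
  also have "\<dots> = (\<Sum>j<length x. real k * (?D (k - 1) (shift 1 j x) + ?D (k - 1) (shift (- 1) j x))
      + (if j = i then ?D k x else 0))"
  proof (rule sum.cong)
    fix j assume "j \<in> {..<length x}"
    then show "?c * free_walks k (shift 1 j x) y + ?c * free_walks k (shift (- 1) j x) y
        = real k * (?D (k - 1) (shift 1 j x) + ?D (k - 1) (shift (- 1) j x)) + (if j = i then ?D k x else 0)"
      by (simp only: move lessThan_iff) (simp add: algebra_simps)
  qed simp
  also have "\<dots> = real k * (\<Sum>j<length x. ?D (k - 1) (shift 1 j x) + ?D (k - 1) (shift (- 1) j x)) + ?D k x"
    using Suc.prems unfolding sum.distrib[of _ "\<lambda>j. if j = i then ?D k x else 0"] sum_distrib_left[symmetric]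
    by simp
  also have "real k * (\<Sum>j<length x. ?D (k - 1) (shift 1 j x) + ?D (k - 1) (shift (- 1) j x))
      = real k * ?D k x"
  proof (cases k)
    case (Suc l)
    then show ?thesis
      by (simp add: shift_commute[of _ i] sum.distrib sum_subtractf)
  qed simp
  finally show ?case by (simp add: algebra_simps)
qed

lemma free_walks_summand:
  assumes "i < length x" "length y = length x"
  shows "real k * (free_walks (k - 1) x (shift 2 i y) - free_walks (k - 1) x y)
    + of_int (y ! i + 1) * free_walks k x (shift 1 i y)
    = of_int (x ! i) * free_walks k (shift (- 1) i x) y"
  using free_walks_derivative[of i x "shift 1 i y" k] assms
  by (simp add: free_walks_shift shift_nth shift_shift algebra_simps)

section \<open>Alternating functions\<close>

text \<open>Antisymmetry is required for neighbouring entries only; these transpositions generate all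
  permutations, and the sign \<open>alt\<close> is easy to follow under them.\<close>

definition alternates :: "nat \<Rightarrow> (int list \<Rightarrow> real) \<Rightarrow> bool" where
  "alternates n f \<longleftrightarrow> (\<forall>u c d v. length (u @ c # d # v) = n \<longrightarrow> f (u @ d # c # v) = - f (u @ c # d # v))"

lemma alternatesD:
  "alternates n f \<Longrightarrow> length (u @ c # d # v) = n \<Longrightarrow> f (u @ d # c # v) = - f (u @ c # d # v)"
  unfolding alternates_def by blast

lemma alternates_move:
  assumes "alternates n f" "length (u @ c # v @ w) = n"
  shows "\<bar>f (u @ c # v @ w)\<bar> = \<bar>f (u @ v @ c # w)\<bar>"
  using assms(2)
proof (induction v arbitrary: u)
  case (Cons d v)
  have "f (u @ d # c # v @ w) = - f (u @ c # d # v @ w)"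
    using Cons.prems by (intro alternatesD[OF assms(1)]) simp
  then show ?case using Cons.IH[of "u @ [d]"] Cons.prems by simp
qed simp

text \<open>By moves of this kind the entries of \<open>w\<close> are brought to the places that they have in \<open>v\<close>, one
  after the other; \<open>u\<close> collects those already in place.\<close>

lemma alternates_abs_mset:
  assumes "alternates n f" "mset v = mset w" "length (u @ v) = n"
  shows "\<bar>f (u @ v)\<bar> = \<bar>f (u @ w)\<bar>"
  using assms(2,3)
proof (induction v arbitrary: u w)
  case (Cons c v)
  then have "c \<in> set w"
    by (metis list.set_intros(1) set_mset_mset)
  then obtain w1 w2 where w: "w = w1 @ c # w2"
    by (meson split_list)
  have v: "mset v = mset (w1 @ w2)"
    using Cons.prems(1) w by simp
  then have len: "length v = length (w1 @ w2)"
    by (rule mset_eq_length)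
  have "\<bar>f (u @ c # v)\<bar> = \<bar>f (u @ c # w1 @ w2)\<bar>"
    using Cons.IH[OF v, of "u @ [c]"] Cons.prems(2) by simp
  also have "\<dots> = \<bar>f (u @ w)\<bar>"
    using alternates_move[OF assms(1), of u c w1 w2] Cons.prems(2) w len by simp
  finally show ?case .
qed simp

lemma alternates_repeated:
  assumes "alternates n f" "length x = n" "\<not> distinct x"
  shows "f x = 0"
proof -
  obtain u v w c where x: "x = u @ [c] @ v @ [c] @ w"
    using not_distinct_decomp[OF assms(3)] by (elim exE)
  let ?z = "c # c # u @ v @ w"
  have mset: "mset x = mset ?z"
    by (simp add: x)
  then have "length ?z = n"
    using assms(2) mset_eq_length by metis
  then have "f ?z = - f ?z"
    using alternatesD[OF assms(1), of "[]" c c "u @ v @ w"] by simp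
  moreover have "\<bar>f x\<bar> = \<bar>f ?z\<bar>"
    using alternates_abs_mset[OF assms(1) mset, of "[]"] assms(2) by simp
  ultimately show ?thesis by linarith
qed

lemma alternates_zero:
  assumes "alternates n f" "length x = n"
    and zero: "\<And>z. length z = n \<Longrightarrow> sorted_wrt (<) z \<Longrightarrow> f z = 0"
  shows "f x = 0"
proof (cases "distinct x")
  case True
  have "\<bar>f x\<bar> = \<bar>f (sort x)\<bar>"
    using alternates_abs_mset[OF assms(1) mset_sort[symmetric], of "[]" x] assms(2) by simp
  moreover have "f (sort x) = 0"
    using True assms(2) by (intro zero) (simp_all add: strict_sorted_iff)
  ultimately show ?thesis by simp
qed (rule alternates_repeated[OF assms(1,2)])

text \<open>Peeling off the first entry turns \<open>alt\<close> into a product over the remaining entries that does not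
  depend on their order, so that a transposition affects a single factor.\<close>

lemma alt_Cons: "alt (c # x) = (\<Prod>d\<leftarrow>x. sgn (d - c)) * alt x"
proof -
  have first: "(\<Prod>d\<leftarrow>x. sgn (d - c)) = (\<Prod>j<length x. sgn (x ! j - c))"
    unfolding prod.list_conv_set_nth atLeast0LessThan by (rule prod.cong) simp_all
  have "alt (c # x) = (\<Prod>j<length x. sgn (x ! j - c) * (\<Prod>i<j. sgn (x ! j - x ! i)))"
    unfolding alt_def list.size(4) add_0_right add_Suc_right One_nat_def prod.lessThan_Suc_shift
    by simp
  then show ?thesis
    by (simp only: first alt_def prod.distrib)
qed

lemma alt_swap: "alt (u @ d # c # v) = - alt (u @ c # d # v)"
proof (induction u)
  case Nil
  have "sgn (c - d) = - sgn (d - c)"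
    by (simp add: sgn_if)
  then show ?case by (simp add: alt_Cons)
next
  case (Cons e u)
  then show ?case by (simp add: alt_Cons)
qed

lemma sort_swap: "sort (u @ d # c # v) = sort (u @ c # d # v)"
  for u v :: "int list"
  by (rule properties_for_sort) simp_all

lemma alternates_alternating_x: "alternates n (\<lambda>x. alternating f k x y)"
  unfolding alternates_def
proof (intro allI impI)
  fix u v :: "int list" and c d
  show "alternating f k (u @ d # c # v) y = - alternating f k (u @ c # d # v) y"
    by (simp add: alternating_def alt_swap[of u d c v] sort_swap[of u d c v])
qed

lemma alternates_alternating_y: "alternates n (\<lambda>y. alternating f k x y)"
  unfolding alternates_def
proof (intro allI impI)
  fix u v :: "int list" and c d
  show "alternating f k x (u @ d # c # v) = - alternating f k x (u @ c # d # v)"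
    by (simp add: alternating_def alt_swap[of u d c v] sort_swap[of u d c v])
qed

lemma alternates_diff:
  assumes "alternates n f" "alternates n g"
  shows "alternates n (\<lambda>x. f x - g x)"
  unfolding alternates_def
proof (intro allI impI)
  fix u v :: "int list" and c d assume "length (u @ c # d # v) = n"
  from alternatesD[OF assms(1) this] alternatesD[OF assms(2) this]
  show "f (u @ d # c # v) - g (u @ d # c # v) = - (f (u @ c # d # v) - g (u @ c # d # v))"
    by linarith
qed

section \<open>Signed sums of unconstrained walks\<close>

text \<open>The Karlin-McGregor sum. It is not written as a determinant of counts for a single walker, because
  only one walker moves at a time and the count of free walks does not factor over the walkers.\<close>

definition signed_walks :: "nat \<Rightarrow> int list \<Rightarrow> int list \<Rightarrow> real" where
  "signed_walks k x y =
     (\<Sum>p | p permutes {..<length y}. of_int (sign p) * free_walks k x (permute_list p y))"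

lemma signed_walks_Suc:
  "signed_walks (Suc k) x y =
     (\<Sum>i<length x. signed_walks k (shift 1 i x) y + signed_walks k (shift (- 1) i x) y)"
proof -
  have "signed_walks (Suc k) x y = (\<Sum>p | p permutes {..<length y}. \<Sum>i<length x.
      of_int (sign p) * free_walks k (shift 1 i x) (permute_list p y)
      + of_int (sign p) * free_walks k (shift (- 1) i x) (permute_list p y))"
    by (simp add: signed_walks_def sum_distrib_left distrib_left)
  then show ?thesis
    by (subst (asm) sum.swap) (simp add: signed_walks_def sum.distrib)
qed

lemma alternates_signed_walks_y: "alternates n (signed_walks k x)"
  unfolding alternates_def
proof (intro allI impI)
  fix u v :: "int list" and c d assume n: "length (u @ c # d # v) = n"
  let ?t = "transpose (length u) (Suc (length u))"
  let ?y = "u @ c # d # v"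
  have t: "?t permutes {..<n}"
    using n by (intro permutes_swap_id) auto
  have swap: "u @ d # c # v = permute_list ?t ?y"
    using n t by (intro nth_equalityI) (auto simp: permute_list_nth nth_append transpose_def nth_Cons split: nat.splits)
  have "signed_walks k x (permute_list ?t ?y) = (\<Sum>p | p permutes {..<n}.
      of_int (sign p) * free_walks k x (permute_list p (permute_list ?t ?y)))"
    using n by (simp add: signed_walks_def)
  also have "\<dots> = (\<Sum>p | p permutes {..<n}.
      - (of_int (sign (?t \<circ> p)) * free_walks k x (permute_list (?t \<circ> p) ?y)))"
  proof (rule sum.cong)
    fix p assume "p \<in> {p. p permutes {..<n}}"
    then have p: "p permutes {..<n}" by simp
    have "sign (?t \<circ> p) = - sign p"
      using p t by (subst sign_compose) (auto intro: permutes_imp_permutation simp: sign_swap_id)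
    moreover have "permute_list (?t \<circ> p) ?y = permute_list p (permute_list ?t ?y)"
      using p n by (intro permute_list_compose) simp
    ultimately show "of_int (sign p) * free_walks k x (permute_list p (permute_list ?t ?y))
        = - (of_int (sign (?t \<circ> p)) * free_walks k x (permute_list (?t \<circ> p) ?y))"
      by simp
  qed simp
  also have "\<dots> = - signed_walks k x ?y"
    using setum_permutations_compose_left[OF t,
        of "\<lambda>p. - (of_int (sign p) * free_walks k x (permute_list p ?y))"] n
    by (simp add: signed_walks_def sum_negf)
  finally show "signed_walks k x (u @ d # c # v) = - signed_walks k x ?y"
    by (simp add: swap)
qed

text \<open>Permuting both end points by \<open>p\<close> turns the term of \<open>inv p\<close>, which has the same sign, into that of
  \<open>p\<close> with the permutation moved from one end point to the other; then the free walks are reversed.\<close>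

lemma signed_walks_symmetric:
  assumes "length x = n" "length y = n"
  shows "signed_walks k x y = signed_walks k y x"
proof -
  have "signed_walks k x y = (\<Sum>p | p permutes {..<n}.
      of_int (sign (inv p)) * free_walks k x (permute_list (inv p) y))"
    using sum_permutations_inverse[of "\<lambda>p. of_int (sign p) * free_walks k x (permute_list p y)" "{..<n}"]
      assms by (simp add: signed_walks_def)
  also have "\<dots> = (\<Sum>p | p permutes {..<n}. of_int (sign p) * free_walks k y (permute_list p x))"
  proof (rule sum.cong)
    fix p assume "p \<in> {p. p permutes {..<n}}"
    then have p: "p permutes {..<n}" by simp
    have "permute_list p (permute_list (inv p) y) = permute_list (inv p \<circ> p) y"
      using p assms by (simp add: permute_list_compose)
    also have "\<dots> = y"
      using permutes_inv_o(2)[OF p] by simp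
    finally have "free_walks k x (permute_list (inv p) y) = free_walks k (permute_list p x) y"
      using free_walks_permute[OF assms(1) _ p, of "permute_list (inv p) y" k] assms by simp
    also have "\<dots> = free_walks k y (permute_list p x)"
      using assms by (intro free_walks_symmetric) simp
    finally show "of_int (sign (inv p)) * free_walks k x (permute_list (inv p) y)
        = of_int (sign p) * free_walks k y (permute_list p x)"
      by (simp add: sign_inverse[OF permutes_imp_permutation[OF finite_lessThan p]])
  qed simp
  finally show ?thesis using assms by (simp add: signed_walks_def)
qed

lemma alternates_signed_walks_x:
  assumes "length y = n"
  shows "alternates n (\<lambda>x. signed_walks k x y)"
  unfolding alternates_def
proof (intro allI impI)
  fix u v :: "int list" and c d assume n: "length (u @ c # d # v) = n"
  from alternatesD[OF alternates_signed_walks_y n, of k y]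
  show "signed_walks k (u @ d # c # v) y = - signed_walks k (u @ c # d # v) y"
    using signed_walks_symmetric[OF n assms] signed_walks_symmetric[of "u @ d # c # v" n y] n assms
    by simp
qed

text \<open>Two increasing tuples are permutations of each other only if they are equal, and then only by the
  identity, because the entries are distinct.\<close>

lemma signed_walks_0:
  assumes "length x = length y" "sorted_wrt (<) x" "sorted_wrt (<) y"
  shows "signed_walks 0 x y = (if x = y then 1 else 0)"
proof -
  have "x = permute_list p y \<longleftrightarrow> x = y \<and> p = id" if p: "p permutes {..<length y}" for p
  proof
    assume eq: "x = permute_list p y"
    then have "set x = set y" using p by simp
    then have xy: "x = y"
      using assms by (intro sorted_distinct_set_unique) (auto simp: strict_sorted_iff)
    have "p i = i" for i
    proof (cases "i < length y")
      case True
      then have "y ! p i = y ! i" "p i < length y"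
        using eq xy p permutes_in_image[OF p, of i] by (metis permute_list_nth, simp)
      then show ?thesis
        using True assms(3) by (simp add: strict_sorted_iff nth_eq_iff_index_eq)
    qed (use p in \<open>auto simp: permutes_def\<close>)
    then show "x = y \<and> p = id" using xy by auto
  qed simp
  then have "signed_walks 0 x y = (\<Sum>p | p permutes {..<length y}. if p = id then if x = y then 1 else 0 else 0)"
    unfolding signed_walks_def by (intro sum.cong) auto
  also have "\<dots> = (if x = y then 1 else 0)"
    by (simp add: finite_permutations permutes_id)
  finally show ?thesis .
qed

section \<open>Non-intersecting walks\<close>

lemma walks_Suc:
  assumes "sorted_wrt (<) x"
  shows "walks (Suc k) x y = (\<Union>z\<in>{z. step x z}. (#) x ` walks k z y)"
proof (intro equalityI subsetI)
  fix w assume w: "w \<in> walks (Suc k) x y"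
  then obtain v where v: "w = x # v" "length v = Suc k"
    by (auto simp: walks_def length_Suc_conv)
  have "v \<in> walks k (v ! 0) y" "step x (v ! 0)"
    using w v unfolding walks_def by fastforce+
  then show "w \<in> (\<Union>z\<in>{z. step x z}. (#) x ` walks k z y)"
    using v by blast
next
  fix w assume "w \<in> (\<Union>z\<in>{z. step x z}. (#) x ` walks k z y)"
  then obtain z v where "step x z" "v \<in> walks k z y" "w = x # v"
    by blast
  then show "w \<in> walks (Suc k) x y"
    using assms by (auto simp: walks_def nth_Cons split: nat.splits)
qed

lemma step_image: "{z. step x z} = (\<lambda>(i, a). shift a i x) ` ({..<length x} \<times> {1, - 1})"
  by (auto simp: step_def image_iff)

lemma inj_on_shift: "inj_on (\<lambda>(i, a). shift a i x) ({..<length x} \<times> {1, - 1})"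
proof (rule inj_onI, clarify)
  fix i a j c
  assume *: "i < length x" "a \<in> {1, - 1}" "c \<in> {1, - 1}" "shift a i x = shift c j x"
  have "shift a i x ! i = shift c j x ! i"
    by (simp only: *(4))
  then have "x ! i + a = (if i = j then x ! i + c else x ! i)"
    unfolding shift_nth[OF *(1)] by simp
  then show "i = j \<and> a = c"
    using *(2,3) by (auto split: if_splits)
qed

lemma finite_walks: "finite (walks k x y)"
proof (induction k arbitrary: x)
  case 0
  have "walks 0 x y \<subseteq> {[x]}"
    by (auto simp: walks_def length_Suc_conv)
  then show ?case by (rule finite_subset) simp
next
  case (Suc k)
  show ?case
  proof (cases "sorted_wrt (<) x")
    case True
    then show ?thesis using Suc by (simp add: walks_Suc step_image)
  next
    case False
    then have "walks (Suc k) x y = {}" by (auto simp: walks_def)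
    then show ?thesis by simp
  qed
qed

lemma b_Suc:
  assumes "sorted_wrt (<) x"
  shows "b (Suc k) x y = (\<Sum>i<length x. b k (shift 1 i x) y + b k (shift (- 1) i x) y)"
proof -
  have "b (Suc k) x y = (\<Sum>z\<in>{z. step x z}. card ((#) x ` walks k z y))"
    unfolding b_def walks_Suc[OF assms]
    by (rule card_UN_disjoint) (auto simp: finite_walks step_image, auto simp: walks_def)
  also have "\<dots> = (\<Sum>z\<in>{z. step x z}. b k z y)"
    by (simp add: b_def card_image)
  also have "\<dots> = (\<Sum>(i, a)\<in>{..<length x} \<times> {1, - 1}. b k (shift a i x) y)"
    unfolding step_image by (subst sum.reindex[OF inj_on_shift]) (simp add: case_prod_beta)
  also have "\<dots> = (\<Sum>i<length x. b k (shift 1 i x) y + b k (shift (- 1) i x) y)"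
    by (simp flip: sum.cartesian_product)
  finally show ?thesis .
qed

text \<open>A unit step from an increasing tuple leads to an increasing tuple or to one with a repeated entry.
  In the latter case both sides are 0, the right-hand one because it is alternating. This is what remains
  of the reflection argument: the two quantities obey one recursion, are both 0 at collisions, and agree at \<open>k = 0\<close>.\<close>

lemma b_eq_signed_walks:
  assumes "length x = length y" "sorted_wrt (<) x" "sorted_wrt (<) y"
  shows "real (b k x y) = signed_walks k x y"
  using assms(1,2)
proof (induction k arbitrary: x)
  case 0
  then show ?case using assms(3) by (simp add: b_0 signed_walks_0)
next
  case (Suc k)
  have "real (b k (shift a i x) y) = signed_walks k (shift a i x) y"
    if "a = 1 \<or> a = - 1" "i < length x" for a i
  proof (cases "distinct (shift a i x)")
    case True
    then have "sorted_wrt (<) (shift a i x)"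
      using shift_increasing_or_repeated[OF Suc.prems(2) _ that(2), of a] that(1) by blast
    then show ?thesis using Suc by simp
  next
    case False
    then have "b k (shift a i x) y = 0"
      by (intro b_not_increasing) (auto simp: strict_sorted_iff)
    moreover have "signed_walks k (shift a i x) y = 0"
      using Suc.prems by (intro alternates_repeated[OF alternates_signed_walks_x _ False]) simp_all
    ultimately show ?thesis by simp
  qed
  then show ?case
    using Suc.prems by (simp add: b_Suc signed_walks_Suc)
qed

lemma alternating_P_eq_signed_walks:
  assumes "length x = n" "length y = n"
  shows "alternating (P n) k x y = signed_walks k x y / (2 * real n) ^ k"
proof -
  let ?c = "(2 * real n) ^ k"
  let ?f = "\<lambda>x y. alternating (P n) k x y - signed_walks k x y / ?c"
  have div: "alternates n (\<lambda>x. f x / ?c)" if "alternates n f" for f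
    using that unfolding alternates_def by (metis minus_divide_left)
  have y: "?f z y = 0" if z: "length z = n" "sorted_wrt (<) z" for z
  proof (rule alternates_zero[of n "?f z"])
    show "alternates n (?f z)"
      by (intro alternates_diff alternates_alternating_y div alternates_signed_walks_y)
    show "?f z z' = 0" if "length z' = n" "sorted_wrt (<) z'" for z'
      using z that by (simp add: alternating_increasing P_def b_eq_signed_walks)
  qed (fact assms(2))
  have "?f x y = 0"
  proof (rule alternates_zero[of n "\<lambda>x. ?f x y"])
    show "alternates n (\<lambda>x. ?f x y)"
      by (intro alternates_diff alternates_alternating_x div alternates_signed_walks_x) (fact assms(2))
  qed (use y assms in simp_all)
  then show ?thesis by simp
qed

section \<open>The difference equations\<close>

text \<open>The expression below is summed over all coordinates, so in the term of a permutation \<open>p\<close> the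
  coordinate \<open>i\<close> of \<open>y\<close> may be replaced by \<open>p i\<close>; the term then is the expression for unconstrained
  walks to the permuted end point, whose summands vanish one by one.\<close>

lemma signed_walks_identity:
  assumes x: "length x = n" and y: "length y = n"
  shows "(\<Sum>i<n. real k * (signed_walks (k - 1) x (shift 2 i y) - signed_walks (k - 1) x y)
      + of_int (y ! i + 1) * signed_walks k x (shift 1 i y))
    = (\<Sum>i<n. of_int (x ! i) * signed_walks k (shift (- 1) i x) y)"
proof -
  let ?G = "\<lambda>p i. real k * (free_walks (k - 1) x (permute_list p (shift 2 i y))
        - free_walks (k - 1) x (permute_list p y))
      + of_int (y ! i + 1) * free_walks k x (permute_list p (shift 1 i y))"
  let ?R = "\<lambda>p i. of_int (x ! i) * free_walks k (shift (- 1) i x) (permute_list p y)"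
  have perm: "(\<Sum>i<n. ?G p i) = (\<Sum>i<n. ?R p i)" if p: "p permutes {..<n}" for p
  proof -
    have "(\<Sum>i<n. ?G p i) = (\<Sum>i<n. ?G p (p i))"
      using sum.permute[OF p, of "?G p"] by (simp add: o_def)
    also have "\<dots> = (\<Sum>i<n. ?R p i)"
    proof (rule sum.cong)
      fix i assume "i \<in> {..<n}"
      then show "?G p (p i) = ?R p i"
        using free_walks_summand[of i x "permute_list p y" k] p x y
        by (simp add: shift_permute_list permute_list_nth)
    qed simp
    finally show ?thesis .
  qed
  have "(\<Sum>i<n. real k * (signed_walks (k - 1) x (shift 2 i y) - signed_walks (k - 1) x y)
      + of_int (y ! i + 1) * signed_walks k x (shift 1 i y))
    = (\<Sum>i<n. \<Sum>p | p permutes {..<n}. of_int (sign p) * ?G p i)"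
    using y by (simp add: signed_walks_def sum_distrib_left sum.distrib sum_subtractf algebra_simps)
  also have "\<dots> = (\<Sum>p | p permutes {..<n}. of_int (sign p) * (\<Sum>i<n. ?G p i))"
    by (subst sum.swap) (simp only: sum_distrib_left)
  also have "\<dots> = (\<Sum>p | p permutes {..<n}. of_int (sign p) * (\<Sum>i<n. ?R p i))"
    by (intro sum.cong refl) (simp only: perm mem_Collect_eq)
  also have "\<dots> = (\<Sum>i<n. \<Sum>p | p permutes {..<n}. of_int (sign p) * ?R p i)"
    by (subst sum.swap) (simp only: sum_distrib_left)
  also have "\<dots> = (\<Sum>i<n. of_int (x ! i) * signed_walks k (shift (- 1) i x) y)"
    using y by (simp add: signed_walks_def sum_distrib_left mult_ac)
  finally show ?thesis .
qed

lemma A1_alternating_P: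
  assumes x: "length x = n" and y: "length y = n"
  shows "A1 n (alternating (P n)) k x y = 0"
proof -
  let ?c = "(2 * real n) ^ k"
  note P = alternating_P_eq_signed_walks
  have drop: "real k / (2 * real n) * (s / (2 * real n) ^ (k - 1)) = real k * s / ?c" for s :: real
    by (cases k) (simp_all add: divide_simps)
  have "A1 n (alternating (P n)) k x y = (\<Sum>i<n.
      real k / (2 * real n) * ((signed_walks (k - 1) x (shift 2 i y) - signed_walks (k - 1) x y)
        / (2 * real n) ^ (k - 1))
      + (of_int (y ! i + 1) * signed_walks k x (shift 1 i y)
        - of_int (x ! i) * signed_walks k (shift (- 1) i x) y) / ?c)"
    unfolding A1_def Lambda_inv_def dplus_y_def dminus_x_def mult_x_def mult_y_def
    using x y by (intro sum.cong refl) (simp add: P shift_nth diff_divide_distrib add_divide_distrib algebra_simps)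
  also have "\<dots> = (\<Sum>i<n. real k * (signed_walks (k - 1) x (shift 2 i y) - signed_walks (k - 1) x y)
      + of_int (y ! i + 1) * signed_walks k x (shift 1 i y)
      - of_int (x ! i) * signed_walks k (shift (- 1) i x) y) / ?c"
    unfolding drop by (simp add: sum_divide_distrib diff_divide_distrib add_divide_distrib algebra_simps)
  also have "\<dots> = 0"
    using signed_walks_identity[OF x y, of k] by (simp add: sum_subtractf)
  finally show ?thesis .
qed

lemma alternating_P_symmetric:
  assumes "length x = n" "length y = n"
  shows "alternating (P n) k x y = alternating (P n) k y x"
  using assms by (simp add: alternating_P_eq_signed_walks signed_walks_symmetric[OF assms])

lemma A2_eq_A1:
  assumes "length x = n" "length y = n"
  shows "A2 n (alternating (P n)) k x y = A1 n (alternating (P n)) k y x"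
  unfolding A1_def A2_def Lambda_inv_def dplus_x_def dplus_y_def dminus_x_def dminus_y_def
    mult_x_def mult_y_def
  using assms by (intro sum.cong refl) (simp add: alternating_P_symmetric[of _ n y] alternating_P_symmetric[of x n])

theorem theorem7p1:
  fixes n k :: nat and x y :: "int list"
  assumes "n \<ge> 1"
    and "length x = n" and "length y = n"
    and "sorted_wrt (<) x" and "sorted_wrt (<) y"
  shows "A1 n (alternating (P n)) k x y = 0 \<and> A2 n (alternating (P n)) k x y = 0"
  using assms by (simp add: A1_alternating_P A2_eq_A1)

end
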